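(* For $\tau\in\mathbb{H}=\{\tau\in\mathbb{C}:\mathrm{Im}(\tau)>0\}$, we have $$\mathcal{F}_1(-\tau)-\mathcal{F}_1(\tau)=\frac{\pi i}{2}E_1(\tau).$$
   Context: For $x\in\mathbb{C}\setminus(-\infty,0]$, let $$\mathcal{F}_1(x)=\sum_{n=1}^\infty\left\{\psi(nx)+\frac{1}{2nx}-\log(nx)\right\}-\frac12\left(\gamma-\log\left(\frac{2\pi}{x}\right)\right),$$ where $\psi=\Gamma'/\Gamma$ is the digamma function, $\gamma$ is Euler's constant, and $\log$ is the principal branch. The weight $1$ Eisenstein series is $$E_1(\tau)=1-4\sum_{m,n\ge1}q^{mn},\qquad q=e^{2\pi i\tau},\ \tau\in\mathbb{H}.$$ *)

theory Defs
  imports "HOL-Complex_Analysis.Complex_Analysis"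
begin

text \<open>
  The series over \<open>n \<ge> 1\<close> is indexed by \<open>Suc n\<close> with \<open>n\<close> ranging over all naturals.  On type
  \<^typ>\<open>complex\<close>, \<^const>\<open>ln\<close> is the principal branch and \<^const>\<open>Digamma\<close> is the logarithmic
  derivative of \<^const>\<open>Gamma\<close>.  The definition is meaningful for \<open>x\<close> outside the
  nonpositive real axis \<open>\<real>\<^sub>\<le>\<^sub>0\<close>; values elsewhere are junk.
\<close>

definition F1 :: "complex \<Rightarrow> complex" where
  "F1 x =
     (\<Sum>n. Digamma (of_nat (Suc n) * x) + 1 / (2 * of_nat (Suc n) * x) - ln (of_nat (Suc n) * x))
     - 1 / 2 * (euler_mascheroni - ln (2 * of_real pi / x))"

text \<open>
  The double series converges absolutely for \<open>Im \<tau> > 0\<close>, so it is taken as an unordered sum over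
  pairs of positive integers.
\<close>

definition E1 :: "complex \<Rightarrow> complex" where
  "E1 \<tau> = 1 - 4 * (\<Sum>\<^sub>\<infinity>(m, n)\<in>{1::nat..} \<times> {1::nat..}. exp (2 * of_real pi * \<i> * \<tau>) ^ (m * n))"

end

theory Submission imports Defs begin

text \<open>
  Write \<open>f z = Digamma z + 1 / (2 z) - Ln z\<close> for the remainder in the leading Stirling
  approximation of the digamma function.  For \<open>z\<close> in the upper half plane, the reflection formula
  \<open>Digamma (1 - z) - Digamma z = \<pi> cot (\<pi> z)\<close>, the recurrence for \<open>Digamma\<close> and
  \<open>Ln z - Ln (- z) = \<pi> \<i>\<close> give \<open>f (- z) - f z = \<pi> cot (\<pi> z) + \<pi> \<i>\<close>.
  With \<open>q = exp (2 \<pi> \<i> z)\<close> the cotangent is \<open>- \<i> - 2 \<i> q / (1 - q)\<close>, so the constant terms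
  cancel and \<open>f (- z) - f z = - 2 \<pi> \<i> q / (1 - q)\<close> is left (\<open>Digamma_remainder_uminus\<close>).
  At \<open>z = n \<tau>\<close> the nome is \<open>q ^ n\<close> with \<open>q = exp (2 \<pi> \<i> \<tau>)\<close>, so summation over \<open>n\<close> produces a
  Lambert series, which is the double series in \<open>E1\<close> after a geometric expansion (\<open>sums_Lambert\<close>).
  The logarithms outside the series differ by \<open>\<pi> \<i>\<close>, which yields the constant term of
  \<open>E1\<close>.

  Subtracting the two series term by term requires one of them to converge; the other then does
  so as well, because the Lambert series converges.  Convergence of \<open>\<Sum>n. f (n \<tau>)\<close> is the only
  analytic point (\<open>summable_Digamma_remainder\<close>).  It needs decay of \<open>f\<close> along a ray, obtained from
  the exact expansion \<open>f z = (\<Sum>k. g (z + k))\<close> in which \<open>g u\<close> is the error of the trapezoidal rule for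
  \<open>1 / t\<close> on the segment from \<open>u\<close> to \<open>u + 1\<close>, a quantity of size \<open>O(1 / u ^ 3)\<close>.
\<close>

section \<open>Summability of the digamma series\<close>

lemma Ln_divide_upper_half_plane:
  fixes u v :: complex
  assumes "Im u > 0" "Im v > 0"
  shows "Ln (u / v) = Ln u - Ln v"
proof -
  have nz: "u \<noteq> 0" "v \<noteq> 0" using assms by auto
  have "0 < Im (Ln u)" "Im (Ln u) < pi" "0 < Im (Ln v)" "Im (Ln v) < pi"
    using Im_Ln_pos_lt[OF nz(1)] Im_Ln_pos_lt[OF nz(2)] assms by auto
  then show ?thesis using nz by (intro Ln_unique) (auto simp: exp_diff)
qed

text \<open>
  The logarithm and the rational function agree to second order at \<open>0\<close>: the derivative of their difference is
  \<open>- w\<^sup>2 / (2 (1 + w)\<^sup>2)\<close>, which is at most \<open>2 |w|\<^sup>2\<close> in modulus on the disc of radius \<open>1 / 2\<close>.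
  For \<open>w = 1 / u\<close> the difference is the error of the trapezoidal rule for \<open>1 / t\<close> between \<open>u\<close> and
  \<open>u + 1\<close>.
\<close>

lemma norm_Ln_minus_trapezoid_le:
  fixes w :: complex
  assumes w: "norm w \<le> 1 / 2"
  shows "norm (Ln (1 + w) - w / 2 * (1 + 1 / (1 + w))) \<le> 2 * norm w ^ 3"
proof -
  define h where "h = (\<lambda>w::complex. Ln (1 + w) - w / 2 * (1 + 1 / (1 + w)))"
  define h' where "h' = (\<lambda>w::complex. - (w\<^sup>2) / (2 * (1 + w)\<^sup>2))"
  have low: "norm (1 + z) \<ge> 1 / 2" if "z \<in> cball 0 (norm w)" for z :: complex
    using norm_triangle_ineq2[of 1 "- z"] that w by (simp add: norm_minus_commute)
  have "(h has_field_derivative h' z) (at z within cball 0 (norm w))"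
    if z: "z \<in> cball 0 (norm w)" for z
  proof -
    have "\<bar>Re z\<bar> \<le> 1 / 2" using abs_Re_le_cmod[of z] z w by simp
    then have nn: "1 + z \<notin> \<real>\<^sub>\<le>\<^sub>0" by (auto simp: complex_nonpos_Reals_iff)
    then have nz: "1 + z \<noteq> 0" by auto
    show ?thesis
      unfolding h_def h'_def
      by (rule derivative_eq_intros refl nn nz | use nn nz in simp; fail)+
        (use nz in \<open>simp add: divide_simps power2_eq_square\<close>, algebra)
  qed
  moreover have "norm (h' z) \<le> 2 * norm w ^ 2" if z: "z \<in> cball 0 (norm w)" for z
  proof -
    have "norm (h' z) = norm z ^ 2 / (2 * norm (1 + z) ^ 2)"
      by (simp add: h'_def norm_divide norm_mult norm_power)
    also have "\<dots> \<le> norm w ^ 2 / (2 * (1 / 2) ^ 2)"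
      using z low[OF z] by (intro frac_le power_mono mult_left_mono) auto
    finally show ?thesis by (simp add: power2_eq_square)
  qed
  ultimately have "norm (h w - h 0) \<le> 2 * norm w ^ 2 * norm (w - 0)"
    by (rule field_differentiable_bound[OF convex_cball]) (simp_all add: dist_norm)
  then show ?thesis by (simp add: h_def power2_eq_square power3_eq_cube mult_ac)
qed

text \<open>
  The logarithms telescope and the trapezoidal weights add up to \<open>\<Sum>1 / (z + k)\<close> apart from half
  of each end term, so a partial sum is the corresponding partial expression of
  the limit \<open>Digamma z = lim (ln m - (\<Sum>k<m. 1 / (z + k)))\<close>, up to
  \<open>Ln (z + m) - ln m\<close> and \<open>1 / (2 (z + m))\<close>, both of which vanish in the limit.
\<close>

lemma sums_Digamma_remainder:
  fixes z :: complex
  assumes z: "Im z > 0"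
  shows "(\<lambda>k. Ln (z + of_nat k + 1) - Ln (z + of_nat k)
            - 1 / 2 * (1 / (z + of_nat k) + 1 / (z + of_nat k + 1)))
         sums (Digamma z + 1 / (2 * z) - Ln z)"
proof -
  define g where "g = (\<lambda>k::nat. Ln (z + of_nat k + 1) - Ln (z + of_nat k)
            - 1 / 2 * (1 / (z + of_nat k) + 1 / (z + of_nat k + 1)))"
  have nz: "z + of_nat k \<noteq> 0" for k using z by (auto simp: complex_eq_iff)
  have partial: "sum g {..<m} = Ln (z + of_nat m) - Ln z
                   - (\<Sum>k<m. inverse (z + of_nat k)) + 1 / (2 * z) - 1 / (2 * (z + of_nat m))" for m
  proof (induction m)
    case (Suc m)
    have "inverse u - 1 / (2 * u) = 1 / (2 * u)" if "u \<noteq> 0" for u :: complex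
      using that by (simp add: divide_simps)
    from this[OF nz[of m]] Suc show ?case
      by (simp add: g_def add_ac ring_distribs)
  qed simp
  have small: "(\<lambda>m. z / of_nat m) \<longlonglongrightarrow> 0"
    by (rule lim_const_over_n)
  have "(\<lambda>m. Ln (1 + z / of_nat m)) \<longlonglongrightarrow> Ln (1 + 0)"
    by (intro tendsto_intros small) auto
  moreover have "\<forall>\<^sub>F m in sequentially.
      Ln (1 + z / of_nat m) = Ln (z + of_nat m) - of_real (ln (real m))"
  proof (rule eventually_sequentiallyI[of 1])
    fix m :: nat assume m: "m \<ge> 1"
    have "1 + z / of_nat m = (z + of_nat m) / of_real (real m)"
      using m by (simp add: field_simps)
    then show "Ln (1 + z / of_nat m) = Ln (z + of_nat m) - of_real (ln (real m))"
      using m nz[of m] Ln_divide_of_real[of "real m" "z + of_nat m"] by (simp add: Ln_of_real)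
  qed
  ultimately have log: "(\<lambda>m. Ln (z + of_nat m) - of_real (ln (real m))) \<longlonglongrightarrow> 0"
    using tendsto_cong[of "\<lambda>m. Ln (1 + z / of_nat m)"] by simp
  have inv: "(\<lambda>m. 1 / (2 * (z + of_nat m))) \<longlonglongrightarrow> 0"
    by (intro tendsto_divide_0[OF tendsto_const] tendsto_mult_filterlim_at_infinity[OF tendsto_const]
        tendsto_add_filterlim_at_infinity[OF tendsto_const] tendsto_of_nat) auto
  have "(\<lambda>m. (of_real (ln (real m)) - (\<Sum>k<m. inverse (z + of_nat k)))
           + (Ln (z + of_nat m) - of_real (ln (real m))) + (1 / (2 * z) - Ln z)
           - 1 / (2 * (z + of_nat m))) \<longlonglongrightarrow> Digamma z + 0 + (1 / (2 * z) - Ln z) - 0"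
    using z by (intro tendsto_intros Digamma_LIMSEQ log inv) auto
  then have "(\<lambda>m. sum g {..<m}) \<longlonglongrightarrow> Digamma z + 1 / (2 * z) - Ln z"
    unfolding partial by (simp add: algebra_simps)
  then show ?thesis by (simp add: sums_def g_def)
qed

text \<open>
  Since \<open>\<tau>\<close> is not real, \<open>n\<close> is controlled by the imaginary part of \<open>n \<tau> + k\<close>, and then \<open>k\<close> by the
  triangle inequality.
\<close>

lemma norm_lattice_ge:
  fixes \<tau> :: complex
  assumes \<tau>: "Im \<tau> > 0"
  obtains C where "C > 0" "\<And>n k :: nat. real n + real k \<le> C * norm (of_nat n * \<tau> + of_nat k)"
proof
  define C where "C = 1 / Im \<tau> + (1 + norm \<tau> / Im \<tau>)"
  show "C > 0" using \<tau> by (auto simp: C_def intro!: add_pos_nonneg)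
  fix n k :: nat
  define N where "N = norm (of_nat n * \<tau> + of_nat k)"
  have "real n * Im \<tau> \<le> N"
    using abs_Im_le_cmod[of "of_nat n * \<tau> + of_nat k"] \<tau> by (simp add: N_def)
  then have n: "real n \<le> N / Im \<tau>" using \<tau> by (simp add: field_simps)
  have "real k = norm ((of_nat n * \<tau> + of_nat k) - of_nat n * \<tau>)" by simp
  also have "\<dots> \<le> N + norm (of_nat n * \<tau>)" unfolding N_def by (rule norm_triangle_ineq4)
  also have "\<dots> \<le> N + N / Im \<tau> * norm \<tau>"
    using mult_right_mono[OF n, of "norm \<tau>"] by (simp add: norm_mult)
  finally show "real n + real k \<le> C * N" using n by (simp add: C_def algebra_simps)
qed

text \<open>
  The \<open>k\<close>-th term of the expansion at \<open>z = n \<tau>\<close> is \<open>O(1 / (n + k)\<^sup>3)\<close>.  Splitting the cube evenly,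
  \<open>(n + k) powr (- 3) \<le> n powr (- 3 / 2) * (k + 1) powr (- 3 / 2)\<close> for \<open>n \<ge> 1\<close>, separates the variables while
  leaving both exponents summable.
\<close>

lemma summable_Digamma_remainder:
  fixes \<tau> :: complex
  assumes \<tau>: "Im \<tau> > 0"
  shows "summable (\<lambda>n. Digamma (of_nat (Suc n) * \<tau>) + 1 / (2 * of_nat (Suc n) * \<tau>)
                        - Ln (of_nat (Suc n) * \<tau>))"
proof -
  obtain C where C: "C > 0" "\<And>n k :: nat. real n + real k \<le> C * norm (of_nat n * \<tau> + of_nat k)"
    using norm_lattice_ge[OF \<tau>] by blast
  define a where "a = (\<lambda>n. real (Suc n) powr (- (3 / 2)))"
  have a: "summable a"
    unfolding a_def by (subst summable_Suc_iff[of "\<lambda>n. real n powr (- (3/2))"]) (simp add: summable_real_powr_iff)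
  define f where "f = (\<lambda>n. Digamma (of_nat (Suc n) * \<tau>) + 1 / (2 * of_nat (Suc n) * \<tau>)
                        - Ln (of_nat (Suc n) * \<tau>))"
  \<comment> \<open>Beyond this threshold the imaginary part of \<open>Suc n * \<tau>\<close> is at least \<open>2\<close>, which brings the
      inverse of \<open>Suc n * \<tau> + k\<close> into the disc of radius \<open>1 / 2\<close> of the cubic estimate.\<close>
  have "norm (f n) \<le> 2 * C ^ 3 * suminf a * a n" if n: "n \<ge> nat \<lceil>2 / Im \<tau>\<rceil>" for n
  proof -
    define z where "z = of_nat (Suc n) * \<tau>"
    define g where "g = (\<lambda>k::nat. Ln (z + of_nat k + 1) - Ln (z + of_nat k)
            - 1 / 2 * (1 / (z + of_nat k) + 1 / (z + of_nat k + 1)))"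
    have z: "Im z > 0" using \<tau> by (simp add: z_def)
    have "2 / Im \<tau> \<le> real (Suc n)" using n by linarith
    then have z2: "Im z \<ge> 2" using \<tau> by (simp add: z_def field_simps)
    have g_le: "norm (g k) \<le> 2 * C ^ 3 * a n * a k" for k
    proof -
      define u where "u = z + of_nat k"
      have u: "Im u \<ge> 2" using z2 by (simp add: u_def)
      then have u2: "norm u \<ge> 2" using abs_Im_le_cmod[of u] by linarith
      then have nz: "u \<noteq> 0" "u + 1 \<noteq> 0" using u by (auto simp: complex_eq_iff)
      have "g k = Ln (1 + 1 / u) - (1 / u) / 2 * (1 + 1 / (1 + 1 / u))"
      proof -
        have "Ln (1 + 1 / u) = Ln (u + 1) - Ln u"
          using Ln_divide_upper_half_plane[of "u + 1" u] u nz by (simp add: add_divide_distrib)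
        moreover have "(1 / u) / 2 * (1 + 1 / (1 + 1 / u)) = 1 / 2 * (1 / u + 1 / (u + 1))"
          using nz by (simp add: divide_simps add.commute)
        ultimately show ?thesis by (simp add: g_def u_def)
      qed
      moreover have "norm (1 / u) \<le> 1 / 2"
        using u2 nz(1) by (simp add: norm_divide divide_simps)
      ultimately have "norm (g k) \<le> 2 * norm (1 / u) ^ 3"
        using norm_Ln_minus_trapezoid_le[of "1 / u"] by simp
      also have "\<dots> = 2 / norm u ^ 3" by (simp add: norm_divide power_divide)
      also have "\<dots> \<le> 2 / ((real (Suc n) + real k) / C) ^ 3"
      proof -
        have "(real (Suc n) + real k) / C \<le> norm u"
          using C(2)[of "Suc n" k] C(1) by (simp add: u_def z_def divide_le_eq mult.commute)
        moreover have "0 < (real (Suc n) + real k) / C" using C(1) by simp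
        ultimately show ?thesis by (intro frac_le power_mono zero_less_power) simp_all
      qed
      also have "\<dots> = 2 * C ^ 3 * (real (Suc n) + real k) powr (- 3)"
        using C(1) by (simp add: powr_minus powr_numeral field_simps)
      also have "(real (Suc n) + real k) powr (- 3) =
          (real (Suc n) + real k) powr (- (3 / 2)) * (real (Suc n) + real k) powr (- (3 / 2))"
        by (simp flip: powr_add)
      also have "\<dots> \<le> a n * a k"
        unfolding a_def by (intro mult_mono powr_mono2') auto
      finally show ?thesis using C(1) by (simp add: mult_ac)
    qed
    have sg: "summable (\<lambda>k. 2 * C ^ 3 * a n * a k)" using a by (rule summable_mult)
    have "f n = suminf g"
      using sums_unique[OF sums_Digamma_remainder[OF z]]
      by (simp add: f_def g_def z_def mult_ac)
    also have "norm \<dots> \<le> (\<Sum>k. 2 * C ^ 3 * a n * a k)"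
      using g_le sg by (rule norm_suminf_le)
    also have "\<dots> = 2 * C ^ 3 * suminf a * a n"
      using suminf_mult[OF a, of "2 * C ^ 3 * a n"] by (simp only: mult_ac)
    finally show ?thesis .
  qed
  then have "summable f"
    by (intro summable_comparison_test'[OF summable_mult[OF a]])
  then show ?thesis by (simp add: f_def)
qed

section \<open>Reflection of the digamma function\<close>

text \<open>
  The logarithmic derivative of \<open>rGamma z * rGamma (1 - z) = sin (\<pi> z) / \<pi>\<close>.
\<close>

lemma Digamma_reflection:
  fixes z :: complex
  assumes z: "z \<notin> \<int>"
  shows "Digamma (1 - z) - Digamma z = of_real pi * cot (of_real pi * z)"
proof -
  have nz: "sin (of_real pi * z) \<noteq> 0"
  proof
    assume "sin (of_real pi * z) = 0"
    then obtain n :: int where "of_real pi * z = of_real (of_int n * pi)" by (auto simp: sin_eq_0)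
    then have "z = of_int n" by simp
    then show False using z by simp
  qed
  have nonpos: "z \<notin> \<int>\<^sub>\<le>\<^sub>0" "1 - z \<notin> \<int>\<^sub>\<le>\<^sub>0"
    using z nonpos_Ints_Int[of z] nonpos_Ints_Int[of "1 - z"] Ints_diff[of 1 "1 - z"] by auto
  have "((\<lambda>z. rGamma z * rGamma (1 - z)) has_field_derivative
          rGamma z * rGamma (1 - z) * (Digamma (1 - z) - Digamma z)) (at z)"
    using nonpos by (auto intro!: derivative_eq_intros simp: algebra_simps)
  also have "(\<lambda>z::complex. rGamma z * rGamma (1 - z)) = (\<lambda>z. sin (of_real pi * z) / of_real pi)"
    by (simp add: rGamma_reflection_complex)
  finally have "((\<lambda>z. sin (of_real pi * z) / of_real pi) has_field_derivative
          sin (of_real pi * z) / of_real pi * (Digamma (1 - z) - Digamma z)) (at z)"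
    by (simp add: rGamma_reflection_complex)
  moreover have "((\<lambda>z. sin (of_real pi * z) / of_real pi) has_field_derivative
          cos (of_real pi * z)) (at z)"
    by (auto intro!: derivative_eq_intros)
  ultimately have "sin (of_real pi * z) / of_real pi * (Digamma (1 - z) - Digamma z)
                     = cos (of_real pi * z)"
    by (rule DERIV_unique)
  then show ?thesis using nz by (simp add: cot_def field_simps)
qed

lemma norm_nome_less_1: "norm (exp (2 * of_real pi * \<i> * z)) < 1" if "Im z > 0" for z
  using that by simp

lemma pi_cot_eq_nome:
  fixes z :: complex
  assumes z: "Im z > 0"
  defines "q \<equiv> exp (2 * of_real pi * \<i> * z)"
  shows "of_real pi * cot (of_real pi * z) = - of_real pi * \<i> - 2 * of_real pi * \<i> * (q / (1 - q))"
proof -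
  define e where "e = exp (\<i> * (of_real pi * z))"
  have q: "q = e * e" by (simp add: q_def e_def mult_ac flip: exp_add)
  have "q \<noteq> 1" using norm_nome_less_1[OF z] by (metis norm_one q_def order.irrefl)
  then have nz: "e \<noteq> 0" "1 - e * e \<noteq> 0" "e * e - 1 \<noteq> 0" using q by (auto simp: e_def)
  have "cot (of_real pi * z) = ((e + inverse e) / 2) / ((e - inverse e) / (2 * \<i>))"
    unfolding cot_def cos_exp_eq sin_exp_eq by (simp add: e_def exp_minus)
  also have "e + inverse e = (e * e + 1) / e" using nz(1) by (simp add: field_simps)
  also have "e - inverse e = (e * e - 1) / e" using nz(1) by (simp add: field_simps)
  also have "(e * e + 1) / e / 2 / ((e * e - 1) / e / (2 * \<i>)) = \<i> * (e * e + 1) / (e * e - 1)"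
    using nz(1,3) by (simp add: divide_simps)
  also have "\<dots> = - \<i> - 2 * \<i> * (q / (1 - q))"
    unfolding q using nz by (simp add: divide_simps) algebra
  finally have cot: "cot (of_real pi * z) = - \<i> - 2 * \<i> * (q / (1 - q))" .
  show ?thesis unfolding cot by (simp add: algebra_simps)
qed

lemma Ln_uminus_upper_half_plane: "Ln (- z) = Ln z - of_real pi * \<i>" if "Im z > 0"
  using that by (subst Ln_minus) (auto simp: mult.commute)

text \<open>
  The correction term \<open>1 / (2 z)\<close> absorbs the \<open>1 / z\<close> that comes from
  \<open>Digamma (1 - z) = Digamma (- z) - 1 / z\<close>, and the branch jump of the logarithm absorbs the limit
  \<open>- \<pi> \<i>\<close> of \<open>\<pi> cot (\<pi> z)\<close> at \<open>\<i> \<infinity>\<close>, so that only exponentially small terms survive.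
\<close>

lemma Digamma_remainder_uminus:
  fixes z :: complex
  assumes z: "Im z > 0"
  defines "q \<equiv> exp (2 * of_real pi * \<i> * z)"
  shows "Digamma (- z) + 1 / (2 * (- z)) - Ln (- z) =
         Digamma z + 1 / (2 * z) - Ln z - 2 * of_real pi * \<i> * (q / (1 - q))"
proof -
  have nz: "z \<noteq> 0" and int: "z \<notin> \<int>" using z by (auto elim!: Ints_cases)
  have "Digamma (- z) = Digamma (1 - z) + 1 / z"
    using Digamma_plus1[of "- z"] nz by simp
  also have "Digamma (1 - z) = Digamma z - of_real pi * \<i> - 2 * of_real pi * \<i> * (q / (1 - q))"
    using Digamma_reflection[OF int] pi_cot_eq_nome[OF z] by (simp add: q_def algebra_simps)
  finally show ?thesis using nz Ln_uminus_upper_half_plane[OF z] by simp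
qed

section \<open>The Lambert series\<close>

text \<open>
  For fixed \<open>m\<close> the inner series is geometric with ratio \<open>q ^ m\<close>.  Absolute convergence over pairs
  follows since the inner sums of absolute values are at most \<open>|q| ^ m / (1 - |q|)\<close>.
\<close>

lemma sums_Lambert:
  fixes q :: complex
  assumes q: "norm q < 1"
  shows "(\<lambda>n. q ^ Suc n / (1 - q ^ Suc n)) sums (\<Sum>\<^sub>\<infinity>(m, n)\<in>{1::nat..} \<times> {1::nat..}. q ^ (m * n))"
proof -
  have range_Suc: "range Suc = {1..}"
    by (auto simp: image_iff Suc_le_eq gr0_conv_Suc)
  have geo: "((\<lambda>n. x ^ n) has_sum x / (1 - x)) {1..}" if "norm x < 1"
    for x :: "'a :: {real_normed_field, banach}"
  proof -
    have "(\<lambda>n. x ^ Suc n) sums (x / (1 - x))"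
      using sums_mult[OF geometric_sums[OF that], of x] by simp
    moreover have "summable (\<lambda>n. norm (x ^ Suc n))"
      using that by (simp add: norm_power norm_mult summable_mult)
    ultimately have "((\<lambda>n. x ^ Suc n) has_sum x / (1 - x)) UNIV"
      by (rule norm_summable_imp_has_sum[rotated])
    then have "((\<lambda>n. x ^ n) has_sum x / (1 - x)) (range Suc)"
      by (subst has_sum_reindex) (auto simp: o_def)
    then show ?thesis by (simp only: range_Suc)
  qed
  have pow: "norm q ^ m < 1" if "m \<ge> 1" for m
    using that q by (auto simp: power_less_one_iff)
  have "(\<lambda>(m, n). norm q ^ (m * n)) summable_on ({1..} \<times> {1..})"
  proof (rule summable_on_SigmaI)
    show "((\<lambda>n. case (m, n) of (m, n) \<Rightarrow> norm q ^ (m * n)) has_sum norm q ^ m / (1 - norm q ^ m)) {1..}"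
      if "m \<in> {1..}" for m
      using geo[of "norm q ^ m"] pow[of m] that by (simp add: power_mult)
    have "(\<lambda>m. norm q ^ m / (1 - norm q)) summable_on {1..}"
      unfolding divide_inverse
      using geo[of "norm q"] q by (intro summable_on_cmult_left) (auto simp: summable_on_def)
    then show "(\<lambda>m. norm q ^ m / (1 - norm q ^ m)) summable_on {1..}"
    proof (rule summable_on_comparison_test)
      fix m :: nat assume m: "m \<in> {1..}"
      have "norm q ^ m \<le> norm q" using m q power_decreasing[of 1 m "norm q"] by simp
      then show "norm q ^ m / (1 - norm q ^ m) \<le> norm q ^ m / (1 - norm q)"
        using q pow[of m] m by (intro divide_left_mono) auto
      show "0 \<le> norm q ^ m / (1 - norm q ^ m)" using pow[of m] m by simp
    qed
  qed auto
  then have "(\<lambda>x. norm (case x of (m, n) \<Rightarrow> q ^ (m * n))) summable_on ({1..} \<times> {1..})"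
    by (simp add: case_prod_unfold norm_power)
  then have "(\<lambda>(m, n). q ^ (m * n)) summable_on ({1..} \<times> {1..})"
    by (rule abs_summable_summable)
  then have "((\<lambda>(m, n). q ^ (m * n)) has_sum (\<Sum>\<^sub>\<infinity>(m, n)\<in>{1..} \<times> {1..}. q ^ (m * n))) ({1..} \<times> {1..})"
    by (rule has_sum_infsum)
  then have "((\<lambda>m. q ^ m / (1 - q ^ m)) has_sum (\<Sum>\<^sub>\<infinity>(m, n)\<in>{1..} \<times> {1..}. q ^ (m * n))) {1..}"
  proof (rule has_sum_SigmaD)
    show "((\<lambda>n. case (m, n) of (m, n) \<Rightarrow> q ^ (m * n)) has_sum q ^ m / (1 - q ^ m)) {1..}"
      if "m \<in> {1..}" for m
      using geo[of "q ^ m"] pow[of m] that by (simp add: power_mult norm_power)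
  qed
  then have "((\<lambda>n. q ^ Suc n / (1 - q ^ Suc n)) has_sum
      (\<Sum>\<^sub>\<infinity>(m, n)\<in>{1..} \<times> {1..}. q ^ (m * n))) UNIV"
    using has_sum_reindex[of Suc UNIV "\<lambda>m. q ^ m / (1 - q ^ m)"] by (simp add: range_Suc o_def)
  then show ?thesis by (rule has_sum_imp_sums)
qed

theorem proposition5p1:
  fixes \<tau> :: complex
  assumes "Im \<tau> > 0"
  shows "F1 (- \<tau>) - F1 \<tau> = of_real pi * \<i> / 2 * E1 \<tau>"
proof -
  define q where "q = exp (2 * of_real pi * \<i> * \<tau>)"
  define L where "L = (\<Sum>\<^sub>\<infinity>(m, n)\<in>{1::nat..} \<times> {1::nat..}. q ^ (m * n))"
  define f where "f = (\<lambda>x n. Digamma (of_nat (Suc n) * x) + 1 / (2 * of_nat (Suc n) * x)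
                              - ln (of_nat (Suc n) * x) :: complex)"
  have f_uminus: "f (- \<tau>) n = f \<tau> n - 2 * of_real pi * \<i> * (q ^ Suc n / (1 - q ^ Suc n))" for n
  proof -
    have "q ^ Suc n = exp (2 * of_real pi * \<i> * (of_nat (Suc n) * \<tau>))"
      unfolding q_def exp_of_nat_mult[symmetric] by (simp only: mult_ac)
    moreover have "Im (of_nat (Suc n) * \<tau>) > 0" using assms by simp
    ultimately show ?thesis
      using Digamma_remainder_uminus[of "of_nat (Suc n) * \<tau>"]
      by (simp only: f_def mult_minus_right mult.assoc)
  qed
  have "f \<tau> sums suminf (f \<tau>)"
    unfolding f_def by (rule summable_sums[OF summable_Digamma_remainder[OF assms]])
  moreover have "(\<lambda>n. q ^ Suc n / (1 - q ^ Suc n)) sums L"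
    unfolding L_def q_def by (rule sums_Lambert[OF norm_nome_less_1[OF assms]])
  ultimately have "f (- \<tau>) sums (suminf (f \<tau>) - 2 * of_real pi * \<i> * L)"
    unfolding f_uminus[abs_def] by (intro sums_diff sums_mult)
  then have series: "suminf (f (- \<tau>)) = suminf (f \<tau>) - 2 * of_real pi * \<i> * L"
    by (rule sums_unique[symmetric])
  have "Im (2 * of_real pi / (- \<tau>)) > 0"
    using assms by (simp add: Im_divide divide_simps sum_power2_gt_zero_iff)
  then have "ln (2 * of_real pi / \<tau>) = ln (2 * of_real pi / (- \<tau>)) - of_real pi * \<i>"
    using Ln_uminus_upper_half_plane[of "2 * of_real pi / (- \<tau>)"] by simp
  then show ?thesis
    unfolding F1_def E1_def using series by (simp add: f_def L_def q_def algebra_simps)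
qed

end
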